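(* As $k\to\infty$ over odd integers, $\gamma_k = O\left(k^{-3}(\log k)^3\right)$; that is, there exist constants $C>0$ and $k_0$ such that $\gamma_k\leq C\,k^{-3}(\log k)^3$ for every odd integer $k\geq k_0$.
   Context: All graphs are finite and simple. For a graph $G$ on $n\ge 1$ vertices, $\lambda_1\geq\dots\geq\lambda_n$ denote the eigenvalues (with multiplicity) of its adjacency matrix $A(G)$. The odd girth $g_{\text{odd}}$ of $G$ is the length of the shortest odd cycle in $G$, with $g_{\text{odd}}=\infty$ if $G$ has no odd cycles. For an odd integer $k\geq 3$, $\gamma_k$ is the supremum of $\frac{\lambda_1+\lambda_n}{n}$ over all positive integers $n$ and all graphs $G$ on $n$ vertices with $g_{\text{odd}}\geq k$. $\log$ is the natural logarithm. *)

theory Defs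
  imports
    "Graph_Theory.Pair_Digraph"
    "Jordan_Normal_Form.Char_Poly"
    "HOL-Library.Extended_Nat"
begin

text \<open>
  Finite simple graphs are finite symmetric loop-free digraphs without parallel arcs
  (\<^locale>\<open>pair_graph\<close>). A graph on \<open>n\<close> vertices is taken to have vertex set
  \<open>{0..<n}\<close>, so that its adjacency matrix is indexed directly by the vertices; every graph on
  \<open>n\<close> vertices is isomorphic to one of these.
\<close>

definition simple_graphs_on :: "nat \<Rightarrow> nat pair_pre_digraph set" where
  "simple_graphs_on n = {G. pair_graph G \<and> pverts G = {0..<n}}"

definition adjacency_matrix :: "nat pair_pre_digraph \<Rightarrow> real mat" where
  "adjacency_matrix G =
     mat (card (pverts G)) (card (pverts G)) (\<lambda>(i, j). if (i, j) \<in> parcs G then 1 else 0)"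

text \<open>
  The eigenvalues with multiplicity, in decreasing order. Only real roots of the characteristic
  polynomial are listed; for the symmetric matrices considered here these are all the roots,
  so the list has length \<open>n\<close>.
\<close>

definition eigenvalues_desc :: "real mat \<Rightarrow> real list" where
  "eigenvalues_desc A = rev (sorted_list_of_multiset (proots (char_poly A)))"

text \<open>\<open>graph_eigenvalue G i\<close> is \<open>\<lambda>\<^sub>i\<close>, with indices starting at 1.\<close>

definition graph_eigenvalue :: "nat pair_pre_digraph \<Rightarrow> nat \<Rightarrow> real" where
  "graph_eigenvalue G i = eigenvalues_desc (adjacency_matrix G) ! (i - 1)"

text \<open>
  The library's cycles in a symmetric digraph include the closed walks \<open>u, v, u\<close> of length 2, and
  each cycle of the graph occurs with both orientations and all starting points. Neither affects
  the set of odd cycle lengths. The infimum of the empty set in \<^typ>\<open>enat\<close> is \<open>\<infinity>\<close>.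
\<close>

definition odd_girth :: "'a pair_pre_digraph \<Rightarrow> enat" where
  "odd_girth G = Inf {enat (length p) |p. pre_digraph.cycle (with_proj G) p \<and> odd (length p)}"

text \<open>
  The set below is nonempty (take one vertex) and bounded (all eigenvalues are at most \<open>n\<close> in
  absolute value), so the supremum in \<^typ>\<open>real\<close> is the genuine one.
\<close>

definition odd_girth_gamma :: "nat \<Rightarrow> real" where
  "odd_girth_gamma k =
     Sup {(graph_eigenvalue G 1 + graph_eigenvalue G n) / real n |n G.
            n \<ge> 1 \<and> G \<in> simple_graphs_on n \<and> odd_girth G \<ge> enat k}"

end

theory Submission
  imports Defs "HOL-Analysis.Function_Topology" "HOL-Analysis.Convex" "HOL-Real_Asymp.Real_Asymp"
begin

text \<open>
  Let \<open>x\<close> be a unit eigenvector for the largest eigenvalue \<open>\<lambda>\<^sub>1\<close> of a graph on \<open>n\<close> vertices with odd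
  girth at least \<open>k\<close>. Were the graph bipartite, flipping the signs of \<open>x\<close> on one colour class would
  produce the eigenvalue \<open>- \<lambda>\<^sub>1\<close>. High odd girth makes the graph bipartite locally: the distance levels
  around any vertex \<open>v\<close> are independent sets up to distance about \<open>k / 2\<close>. So \<open>x\<close> is multiplied by
  alternating signs and by a cut-off function \<open>\<phi>\<close> of the distance from \<open>v\<close>, and the resulting vector
  is inserted into the Rayleigh quotient. This bounds \<open>\<lambda>\<^sub>1 + \<lambda>\<^sub>n\<close> by the energy
  \<open>\<Sum> (\<phi>(u) - \<phi>(w))\<^sup>2 x(u)\<^sup>2\<close>, taken over adjacent \<open>u\<close> and \<open>w\<close>, divided by the weight
  \<open>\<Sum> \<phi>(u)\<^sup>2 x(u)\<^sup>2\<close> (\<open>eigenvalue_sum_le_cutoff\<close>).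

  Let \<open>\<phi>\<close> fall from 1 to 0 within a block of \<open>L\<close> consecutive levels. An average level has at most
  \<open>n / L\<close> vertices, so \<open>\<phi>\<close> can fall in steps of size \<open>O(1 / L)\<close> between levels that have \<open>O(n / L)\<close>
  vertices. A vertex then contributes at most \<open>O(n / L) O(1 / L)\<^sup>2\<close> times its weight to the energy. If
  the weight (the sum of the squared entries) of \<open>x\<close> in the ball at the end of the block is at most twice the weight in the ball at its
  beginning, it follows that \<open>\<lambda>\<^sub>1 + \<lambda>\<^sub>n = O(n / L ^ 3)\<close> (\<open>eigenvalue_sum_le_of_slow_growth\<close>).

  Such a block exists with \<open>L\<close> of order \<open>k / log k\<close>. It may be assumed that \<open>\<lambda>\<^sub>1 \<ge> n / k ^ 3\<close>, since
  \<open>\<lambda>\<^sub>n \<le> 0\<close>. For a suitable \<open>v\<close> the ball of radius 1 then has weight at least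
  \<open>(\<lambda>\<^sub>1 / n)\<^sup>2 \<ge> 1 / k ^ 6\<close> (\<open>eigenvector_neighbourhood_weight\<close>), and all of \<open>x\<close> has weight 1. So the
  weight can double over at most \<open>O(log k)\<close> of the blocks into which the first \<open>k / 2\<close> levels are
  divided.
\<close>

section \<open>Minimising a quadratic form\<close>

definition quad_form :: "'a set \<Rightarrow> ('a \<Rightarrow> 'a \<Rightarrow> real) \<Rightarrow> ('a \<Rightarrow> real) \<Rightarrow> real" where
  "quad_form V a y = (\<Sum>u\<in>V. \<Sum>w\<in>V. a u w * y u * y w)"

text \<open>
  Compactness of the unit sphere. Restricting to functions that vanish outside \<open>V\<close> puts the sphere
  inside a product of compact intervals, so Tychonoff's theorem gives the minimum.
\<close>
lemma quad_form_min_exists: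
  fixes a :: "'a \<Rightarrow> 'a \<Rightarrow> real"
  assumes fin: "finite V" and ne: "V \<noteq> {}"
  obtains m z where "(\<Sum>u\<in>V. (z u)\<^sup>2) = 1" "quad_form V a z = m"
    "\<And>y. m * (\<Sum>u\<in>V. (y u)\<^sup>2) \<le> quad_form V a y"
proof -
  define K where "K = Pi\<^sub>E UNIV (\<lambda>i. if i \<in> V then {-1..1::real} else {0})"
  define S where "S = K \<inter> {y. (\<Sum>u\<in>V. (y u)\<^sup>2) = 1}"
  have coord: "continuous_on UNIV (\<lambda>y::'a \<Rightarrow> real. y i)" for i
    by (rule continuous_on_product_coordinates)
  have "compactin (product_topology (\<lambda>i. euclidean) UNIV) K"
    unfolding K_def compactin_PiE by auto
  then have "compact K"
    by (simp add: euclidean_product_topology)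
  moreover have "closed {y::'a \<Rightarrow> real. (\<Sum>u\<in>V. (y u)\<^sup>2) = 1}"
    by (intro closed_Collect_eq continuous_intros coord)
  ultimately have comp: "compact S"
    unfolding S_def by (rule compact_Int_closed)
  obtain v where v: "v \<in> V" using ne by auto
  have "(\<lambda>u. if u = v then 1 else 0) \<in> S"
    using v fin by (auto simp: S_def K_def if_distrib[of "\<lambda>t. t^2"] cong: if_cong)
  then have Sne: "S \<noteq> {}" by auto
  have cont: "continuous_on S (quad_form V a)"
    unfolding quad_form_def
    by (intro continuous_intros continuous_on_subset[OF coord]) auto
  obtain z where z: "z \<in> S" "\<forall>y\<in>S. quad_form V a z \<le> quad_form V a y"
    using continuous_attains_inf[OF comp Sne cont] by auto
  have "quad_form V a z * (\<Sum>u\<in>V. (y u)\<^sup>2) \<le> quad_form V a y" for y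
  proof (cases "(\<Sum>u\<in>V. (y u)\<^sup>2) = 0")
    case True
    then have "\<forall>u\<in>V. y u = 0"
      using fin by (simp add: sum_nonneg_eq_0_iff)
    then have "quad_form V a y = 0" by (simp add: quad_form_def)
    then show ?thesis using True by simp
  next
    case False
    define N where "N = (\<Sum>u\<in>V. (y u)\<^sup>2)"
    have N: "N > 0" using False sum_nonneg[of V "\<lambda>u. (y u)\<^sup>2"] unfolding N_def by fastforce
    define y' where "y' = (\<lambda>i. if i \<in> V then y i / sqrt N else 0)"
    have "(y i)\<^sup>2 \<le> N" if "i \<in> V" for i
      unfolding N_def using fin that by (intro member_le_sum) auto
    then have "\<bar>y i\<bar> \<le> sqrt N" if "i \<in> V" for i
      using that real_le_rsqrt by (metis power2_abs)
    then have "\<bar>y i / sqrt N\<bar> \<le> 1" if "i \<in> V" for i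
      using that N by simp
    then have "y' \<in> K"
      unfolding K_def y'_def by (fastforce simp: abs_le_iff simp del: abs_divide)
    moreover have "(\<Sum>u\<in>V. (y' u)\<^sup>2) = 1"
    proof -
      have "(\<Sum>u\<in>V. (y' u)\<^sup>2) = (\<Sum>u\<in>V. (y u)\<^sup>2 / N)"
        using N by (intro sum.cong) (auto simp: y'_def power_divide)
      also have "\<dots> = N / N" unfolding N_def by (rule sum_divide_distrib[symmetric])
      finally show ?thesis using N by simp
    qed
    ultimately have "y' \<in> S" by (auto simp: S_def)
    then have "quad_form V a z \<le> quad_form V a y'" using z by auto
    also have "quad_form V a y' = (\<Sum>u\<in>V. \<Sum>w\<in>V. a u w * y u * y w / N)"
      unfolding quad_form_def using N by (intro sum.cong refl) (auto simp: y'_def)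
    also have "\<dots> = quad_form V a y / N"
      by (simp add: quad_form_def sum_divide_distrib)
    finally show ?thesis using N by (simp add: N_def field_simps)
  qed
  then show ?thesis
    using that[of z "quad_form V a z"] z by (auto simp: S_def)
qed

lemma linear_term_zero_if_quadratic_nonneg:
  fixes b c :: real
  assumes "\<And>t. 0 \<le> 2 * t * b + t\<^sup>2 * c"
  shows "b = 0"
proof (rule ccontr)
  assume "b \<noteq> 0"
  define d where "d = \<bar>c\<bar> + 1"
  have d: "d > 0" "c \<le> d" by (auto simp: d_def)
  have "0 \<le> 2 * (- b / d) * b + (- b / d)\<^sup>2 * c" by (rule assms)
  also have "\<dots> \<le> 2 * (- b / d) * b + (- b / d)\<^sup>2 * d"
    using d by (intro add_left_mono mult_left_mono) auto
  also have "\<dots> = - (b\<^sup>2 / d)" using d by (simp add: power2_eq_square field_simps)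
  also have "\<dots> < 0" using d \<open>b \<noteq> 0\<close> by simp
  finally show False by simp
qed

text \<open>
  A minimiser \<open>z\<close> of the Rayleigh quotient is perturbed in the direction \<open>d\<close> of its own residual
  \<open>a z - m z\<close>. Minimality makes the term linear in the perturbation vanish, and that term is the
  squared norm of \<open>d\<close>.
\<close>
lemma quad_form_minimiser_eigen:
  fixes a :: "'a \<Rightarrow> 'a \<Rightarrow> real"
  assumes fin: "finite V"
    and sym: "\<And>u w. u \<in> V \<Longrightarrow> w \<in> V \<Longrightarrow> a u w = a w u"
    and min: "\<And>y. m * (\<Sum>u\<in>V. (y u)\<^sup>2) \<le> quad_form V a y"
    and att: "quad_form V a z = m * (\<Sum>u\<in>V. (z u)\<^sup>2)"
    and u: "u \<in> V"
  shows "(\<Sum>w\<in>V. a u w * z w) = m * z u"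
proof -
  define d where "d u = (\<Sum>w\<in>V. a u w * z w) - m * z u" for u
  have "(\<Sum>u\<in>V. (d u)\<^sup>2) = 0"
  proof (rule linear_term_zero_if_quadratic_nonneg)
    fix t :: real
    have swap: "(\<Sum>u\<in>V. \<Sum>w\<in>V. a u w * z u * d w) = (\<Sum>u\<in>V. \<Sum>w\<in>V. a u w * d u * z w)"
      by (subst sum.swap) (auto intro!: sum.cong simp: sym)
    have "quad_form V a (\<lambda>u. z u + t * d u) = quad_form V a z
        + t * (\<Sum>u\<in>V. \<Sum>w\<in>V. a u w * z u * d w) + t * (\<Sum>u\<in>V. \<Sum>w\<in>V. a u w * d u * z w)
        + t\<^sup>2 * quad_form V a d"
      unfolding quad_form_def sum_distrib_left sum.distrib[symmetric]
      by (intro sum.cong refl) (auto simp: algebra_simps power2_eq_square)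
    also have "\<dots> = quad_form V a z + 2 * t * (\<Sum>u\<in>V. d u * (\<Sum>w\<in>V. a u w * z w)) + t\<^sup>2 * quad_form V a d"
      unfolding swap by (simp add: sum_distrib_left mult_ac)
    finally have q: "quad_form V a (\<lambda>u. z u + t * d u) = \<dots>" .
    have n: "(\<Sum>u\<in>V. (z u + t * d u)\<^sup>2)
        = (\<Sum>u\<in>V. (z u)\<^sup>2) + 2 * t * (\<Sum>u\<in>V. d u * z u) + t\<^sup>2 * (\<Sum>u\<in>V. (d u)\<^sup>2)"
      unfolding sum_distrib_left sum.distrib[symmetric]
      by (intro sum.cong refl) (auto simp: algebra_simps power2_eq_square)
    have l: "(\<Sum>u\<in>V. (d u)\<^sup>2) = (\<Sum>u\<in>V. d u * (\<Sum>w\<in>V. a u w * z w)) - m * (\<Sum>u\<in>V. d u * z u)"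
      unfolding sum_distrib_left[of m] sum_subtractf[symmetric]
      by (intro sum.cong refl) (simp add: d_def power2_eq_square algebra_simps)
    have "m * (\<Sum>u\<in>V. (z u + t * d u)\<^sup>2) \<le> quad_form V a (\<lambda>u. z u + t * d u)"
      by (rule min)
    then show "0 \<le> 2 * t * (\<Sum>u\<in>V. (d u)\<^sup>2) + t\<^sup>2 * (quad_form V a d - m * (\<Sum>u\<in>V. (d u)\<^sup>2))"
      unfolding q n att by (subst l) (simp add: algebra_simps)
  qed
  then have "d u = 0" using u fin by (simp add: sum_nonneg_eq_0_iff)
  then show ?thesis by (simp add: d_def)
qed

section \<open>Extreme eigenvalues of real symmetric matrices\<close>

text \<open>
  The characteristic polynomial splits over the complex numbers, and the roots are real because
  \<open>v\<^sup>* A v\<close> is real for every complex vector \<open>v\<close>. Hence the list of real roots has full length, and its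
  last entry at position \<open>n - 1\<close> really is the least eigenvalue.
\<close>
lemma real_symmetric_char_poly_splits:
  fixes A :: "real mat"
  assumes A: "A \<in> carrier_mat n n"
    and sym: "\<And>i j. i < n \<Longrightarrow> j < n \<Longrightarrow> A $$ (i, j) = A $$ (j, i)"
  obtains bs where "char_poly A = (\<Prod>b\<leftarrow>bs. [:- b, 1:])" "length bs = n"
proof -
  interpret cr: map_poly_inj_idom_hom complex_of_real ..
  define C where "C = map_mat complex_of_real A"
  have C: "C \<in> carrier_mat n n" using A by (simp add: C_def)
  obtain cs where cs: "char_poly C = (\<Prod>c\<leftarrow>cs. [:- c, 1:])" "length cs = n"
    using char_poly_factorized[OF C] by auto
  have real: "of_real (Re c) = c" if "c \<in> set cs" for c
  proof -
    have "poly (char_poly C) c = 0"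
      unfolding cs poly_prod_list using that by (auto simp: prod_list_zero_iff o_def)
    then have "eigenvalue C c"
      using eigenvalue_root_char_poly[OF C] by simp
    then obtain v where v: "v \<in> carrier_vec n" "v \<noteq> 0\<^sub>v n" "C *\<^sub>v v = c \<cdot>\<^sub>v v"
      using C by (auto simp: eigenvalue_def eigenvector_def)
    have row: "c * v $ i = (\<Sum>j<n. of_real (A $$ (i, j)) * v $ j)" if "i < n" for i
    proof -
      have "c * v $ i = (C *\<^sub>v v) $ i" using v that by simp
      also have "\<dots> = (\<Sum>j<n. of_real (A $$ (i, j)) * v $ j)"
        using A v(1) that by (auto simp: C_def scalar_prod_def lessThan_atLeast0)
      finally show ?thesis .
    qed
    define S where "S = (\<Sum>i<n. of_real ((cmod (v $ i))\<^sup>2) :: complex)"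
    define Q where "Q = (\<Sum>i<n. \<Sum>j<n. cnj (v $ i) * of_real (A $$ (i, j)) * v $ j)"
    have "c * S = (\<Sum>i<n. cnj (v $ i) * (c * v $ i))"
      unfolding S_def sum_distrib_left
      by (intro sum.cong refl) (simp only: complex_norm_square, simp add: mult_ac)
    also have "\<dots> = Q"
      unfolding Q_def by (intro sum.cong refl) (simp add: row sum_distrib_left mult_ac)
    finally have "c * S = Q" .
    moreover have "cnj Q = Q"
    proof -
      have "cnj Q = (\<Sum>i<n. \<Sum>j<n. v $ i * of_real (A $$ (i, j)) * cnj (v $ j))"
        by (simp add: Q_def)
      also have "\<dots> = (\<Sum>j<n. \<Sum>i<n. v $ i * of_real (A $$ (i, j)) * cnj (v $ j))"
        by (rule sum.swap)
      also have "\<dots> = Q"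
        unfolding Q_def by (intro sum.cong refl) (simp add: sym mult_ac)
      finally show ?thesis .
    qed
    moreover have "cnj S = S" by (simp add: S_def)
    moreover have "S \<noteq> 0"
    proof -
      obtain i where i: "i < n" "v $ i \<noteq> 0"
        using v(1,2) by (metis carrier_vecD eq_vecI index_zero_vec)
      have "(\<Sum>i<n. (cmod (v $ i))\<^sup>2) \<noteq> 0"
        using i by (subst sum_nonneg_eq_0_iff) auto
      then show ?thesis unfolding S_def of_real_sum[symmetric] of_real_eq_0_iff .
    qed
    ultimately have "cnj c = c"
      by (metis complex_cnj_mult mult_right_cancel)
    then show ?thesis by (simp add: complex_eq_iff)
  qed
  define bs where "bs = map Re cs"
  have "map complex_of_real bs = cs"
    using real by (simp add: bs_def map_idI)
  then have "char_poly C = (\<Prod>b\<leftarrow>bs. [:- complex_of_real b, 1:])"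
    using cs(1) by (metis (no_types, lifting) list.map_comp map_eq_conv o_apply)
  also have "\<dots> = map_poly of_real (\<Prod>b\<leftarrow>bs. [:- b, 1:])"
    by (simp add: cr.hom_prod_list o_def of_real_hom.map_poly_pCons_hom)
  finally have "map_poly complex_of_real (char_poly A) = map_poly of_real (\<Prod>b\<leftarrow>bs. [:- b, 1:])"
    unfolding C_def by (simp add: of_real_hom.char_poly_hom[OF A])
  then have "char_poly A = (\<Prod>b\<leftarrow>bs. [:- b, 1:])"
    by (rule cr.injectivity)
  then show ?thesis using that[of bs] cs(2) by (simp add: bs_def)
qed

lemma proots_prod_list_linear: "proots (\<Prod>b\<leftarrow>bs. [:- b, 1:]) = mset (bs :: 'a :: idom list)"
proof (induction bs)
  case (Cons b bs)
  have "(\<Prod>b\<leftarrow>bs. [:- b, 1:]) \<noteq> 0" by (auto simp: prod_list_zero_iff)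
  then show ?case using Cons by (simp add: proots_mult del: mult_pCons_left)
qed simp

lemma symmetric_extreme_eigenvalues:
  fixes A :: "real mat"
  assumes A: "A \<in> carrier_mat n n" and n: "n \<ge> 1"
    and sym: "\<And>i j. i < n \<Longrightarrow> j < n \<Longrightarrow> A $$ (i, j) = A $$ (j, i)"
  shows "eigenvalue A (eigenvalues_desc A ! 0)"
    and "eigenvalue A m \<Longrightarrow> eigenvalues_desc A ! (n - 1) \<le> m"
proof -
  obtain bs where bs: "char_poly A = (\<Prod>b\<leftarrow>bs. [:- b, 1:])" "length bs = n"
    using real_symmetric_char_poly_splits[OF A sym] .
  have desc: "eigenvalues_desc A = rev (sort bs)"
    by (simp add: eigenvalues_desc_def bs(1) proots_prod_list_linear)
  have ev: "eigenvalue A b \<longleftrightarrow> b \<in> set bs" for b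
    by (auto simp: eigenvalue_root_char_poly[OF A] bs(1) poly_prod_list prod_list_zero_iff o_def)
  have "eigenvalues_desc A ! 0 \<in> set (eigenvalues_desc A)"
    by (rule nth_mem) (use desc bs n in simp)
  then show "eigenvalue A (eigenvalues_desc A ! 0)"
    unfolding ev by (simp add: desc)
  assume "eigenvalue A m"
  then obtain i where i: "i < n" "sort bs ! i = m"
    unfolding ev using bs(2) by (metis in_set_conv_nth length_sort set_sort)
  have "eigenvalues_desc A ! (n - 1) = sort bs ! 0"
    using n bs(2) by (simp add: desc rev_nth)
  also have "\<dots> \<le> sort bs ! i"
    using i bs(2) by (intro sorted_nth_mono) auto
  finally show "eigenvalues_desc A ! (n - 1) \<le> m" using i by simp
qed

lemma eigenvalue_mat_iff:
  fixes a :: "nat \<Rightarrow> nat \<Rightarrow> 'a :: field"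
  shows "eigenvalue (mat n n (\<lambda>(i, j). a i j)) m \<longleftrightarrow>
    (\<exists>z. (\<exists>u<n. z u \<noteq> 0) \<and> (\<forall>u<n. (\<Sum>w<n. a u w * z w) = m * z u))"
    (is "eigenvalue ?A m \<longleftrightarrow> ?R")
proof
  assume "eigenvalue ?A m"
  then obtain v where v: "v \<in> carrier_vec n" "v \<noteq> 0\<^sub>v n" "?A *\<^sub>v v = m \<cdot>\<^sub>v v"
    by (auto simp: eigenvalue_def eigenvector_def)
  have "(\<Sum>w<n. a u w * v $ w) = m * v $ u" if "u < n" for u
  proof -
    have "(\<Sum>w<n. a u w * v $ w) = (?A *\<^sub>v v) $ u"
      using v(1) that by (auto simp: scalar_prod_def lessThan_atLeast0)
    also have "\<dots> = m * v $ u" using v that by simp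
    finally show ?thesis .
  qed
  moreover have "\<exists>u<n. v $ u \<noteq> 0"
    using v(1,2) by (metis carrier_vecD eq_vecI index_zero_vec)
  ultimately show ?R by blast
next
  assume ?R
  then obtain z u0 where z: "u0 < n" "z u0 \<noteq> 0"
    "\<And>u. u < n \<Longrightarrow> (\<Sum>w<n. a u w * z w) = m * z u" by blast
  have "vec n z \<noteq> 0\<^sub>v n" using z(1,2) by (metis index_vec index_zero_vec(1))
  moreover have "?A *\<^sub>v vec n z = m \<cdot>\<^sub>v vec n z"
  proof (rule eq_vecI)
    fix i assume "i < dim_vec (m \<cdot>\<^sub>v vec n z)"
    then show "(?A *\<^sub>v vec n z) $ i = (m \<cdot>\<^sub>v vec n z) $ i"
      using z(3)[of i] by (auto simp: scalar_prod_def lessThan_atLeast0)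
  qed simp
  ultimately show "eigenvalue ?A m"
    unfolding eigenvalue_def eigenvector_def by (intro exI[of _ "vec n z"]) auto
qed

text \<open>
  Half of the variational principle suffices at each end of the spectrum: at the top an eigenvector
  is enough, and at the bottom the minimum of the Rayleigh quotient is itself an eigenvalue, so it
  is at least the last one in the list.
\<close>
lemma extreme_eigenvalues:
  fixes a :: "nat \<Rightarrow> nat \<Rightarrow> real"
  assumes n: "n \<ge> 1"
    and sym: "\<And>u w. u < n \<Longrightarrow> w < n \<Longrightarrow> a u w = a w u"
  defines "A \<equiv> mat n n (\<lambda>(i, j). a i j)"
  shows largest_eigenvalue_unit_eigenvector:
      "\<exists>x. (\<Sum>u<n. (x u)\<^sup>2) = 1 \<and>
        (\<forall>u<n. (\<Sum>w<n. a u w * x w) = eigenvalues_desc A ! 0 * x u)"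
    and least_eigenvalue_le_quad_form:
      "eigenvalues_desc A ! (n - 1) * (\<Sum>u<n. (y u)\<^sup>2) \<le> quad_form {..<n} a y"
proof -
  have A: "A \<in> carrier_mat n n" "\<And>i j. i < n \<Longrightarrow> j < n \<Longrightarrow> A $$ (i, j) = A $$ (j, i)"
    by (auto simp: A_def sym)
  have "eigenvalue A (eigenvalues_desc A ! 0)"
    by (rule symmetric_extreme_eigenvalues(1)[OF A(1) n A(2)])
  then obtain x u0 where x: "u0 < n" "x u0 \<noteq> 0"
    "\<And>u. u < n \<Longrightarrow> (\<Sum>w<n. a u w * x w) = eigenvalues_desc A ! 0 * x u"
    unfolding A_def eigenvalue_mat_iff by blast
  define N where "N = (\<Sum>u<n. (x u)\<^sup>2)"
  have N: "N > 0" unfolding N_def using x(1,2) by (intro sum_pos2[of _ u0]) auto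
  have "(\<Sum>u<n. (x u / sqrt N)\<^sup>2) = N / N"
    using N by (simp add: power_divide flip: sum_divide_distrib N_def)
  moreover have "(\<Sum>w<n. a u w * (x w / sqrt N)) = eigenvalues_desc A ! 0 * (x u / sqrt N)"
    if "u < n" for u
    using x(3)[OF that] by (simp add: sum_divide_distrib[symmetric])
  ultimately show "\<exists>x. (\<Sum>u<n. (x u)\<^sup>2) = 1 \<and>
      (\<forall>u<n. (\<Sum>w<n. a u w * x w) = eigenvalues_desc A ! 0 * x u)"
    using N by (intro exI[of _ "\<lambda>u. x u / sqrt N"]) simp
next
  have A: "A \<in> carrier_mat n n" "\<And>i j. i < n \<Longrightarrow> j < n \<Longrightarrow> A $$ (i, j) = A $$ (j, i)"
    by (auto simp: A_def sym)
  have V: "finite {..<n}" "{..<n} \<noteq> {}" using n by (auto simp: lessThan_empty_iff)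
  obtain m z where z: "(\<Sum>u<n. (z u)\<^sup>2) = 1" "quad_form {..<n} a z = m"
    and min: "\<And>y. m * (\<Sum>u<n. (y u)\<^sup>2) \<le> quad_form {..<n} a y"
    using quad_form_min_exists[OF V, of a] by metis
  have "(\<Sum>w<n. a u w * z w) = m * z u" if "u < n" for u
    using that z by (intro quad_form_minimiser_eigen[OF V(1) _ min]) (auto simp: sym)
  moreover have "\<exists>u<n. z u \<noteq> 0"
  proof (rule ccontr)
    assume "\<not> (\<exists>u<n. z u \<noteq> 0)"
    then have "(\<Sum>u<n. (z u)\<^sup>2) = 0" by simp
    with z(1) show False by simp
  qed
  ultimately have "eigenvalue A m" unfolding A_def eigenvalue_mat_iff by blast
  then have "eigenvalues_desc A ! (n - 1) \<le> m"
    using symmetric_extreme_eigenvalues(2)[OF A(1) n A(2)] by blast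
  then have "eigenvalues_desc A ! (n - 1) * (\<Sum>u<n. (y u)\<^sup>2) \<le> m * (\<Sum>u<n. (y u)\<^sup>2)"
    by (intro mult_right_mono sum_nonneg) auto
  with min[of y] show "eigenvalues_desc A ! (n - 1) * (\<Sum>u<n. (y u)\<^sup>2) \<le> quad_form {..<n} a y"
    by simp
qed

section \<open>Distance levels in graphs of high odd girth\<close>

text \<open>
  A repeated vertex splits a closed walk into two shorter closed walks, one of which is odd.
\<close>
lemma (in wf_digraph) odd_closed_walk_contains_odd_cycle:
  assumes "awalk u p u" "odd (length p)"
  shows "\<exists>q. cycle q \<and> odd (length q) \<and> length q \<le> length p"
  using assms
proof (induction "length p" arbitrary: u p rule: less_induct)
  case less
  obtain e es where p: "p = e # es"
    using less.prems(2) by (cases p) auto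
  show ?case
  proof (cases "distinct (tl (awalk_verts u p))")
    case True
    then have "cycle p" using less.prems p by (auto simp: cycle_def)
    then show ?thesis using less.prems(2) by blast
  next
    case False
    have e: "awalk (head G e) es u" "awalk u [e] (head G e)"
      using less.prems(1) p by (auto simp: awalk_Cons_iff awalk_Nil_iff)
    have "\<not> distinct (awalk_verts (head G e) es)"
      using False p by simp
    then obtain q r s w where d: "es = q @ r @ s" "0 < length r"
        "awalk (head G e) q w" "awalk w r w" "awalk w s u"
      using awalk_not_distinct_decomp[OF e(1)] by blast
    show ?thesis
    proof (cases "odd (length r)")
      case True
      then show ?thesis
        using less.hyps[OF _ d(4)] p d(1,2) by fastforce
    next
      case False
      have "awalk u ([e] @ q @ s) u"
        by (intro awalk_appendI[OF e(2)] awalk_appendI[OF d(3) d(5)])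
      moreover have "odd (length ([e] @ q @ s))" "length ([e] @ q @ s) < length p"
        using False less.prems(2) p d(1,2) by auto
      ultimately show ?thesis
        using less.hyps by (meson less_imp_le order_trans)
    qed
  qed
qed

lemma (in pair_graph) no_short_odd_closed_walk:
  assumes "enat k \<le> odd_girth G" "awalk u p u" "odd (length p)"
  shows "k \<le> length p"
proof -
  obtain q where q: "cycle q" "odd (length q)" "length q \<le> length p"
    using odd_closed_walk_contains_odd_cycle[OF assms(2,3)] by auto
  have "odd_girth G \<le> enat (length q)"
    unfolding odd_girth_def using q by (intro Inf_lower) auto
  with assms(1) q(3) show ?thesis
    by (metis enat_ord_simps(1) order_trans)
qed

text \<open>
  The levels are the distances from \<open>v\<close>, cut off at \<open>r\<close>; the cut-off also covers the vertices that
  cannot be reached from \<open>v\<close>. An edge inside a level \<open>i < r\<close> would close up with two shortest walks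
  from \<open>v\<close> to an odd closed walk of length \<open>2 * i + 1 < k\<close>.
\<close>
lemma (in pair_graph) truncated_distance:
  assumes girth: "enat k \<le> odd_girth G" and r: "2 * r \<le> k" and v: "v \<in> pverts G"
  obtains lev :: "'a \<Rightarrow> nat" where "lev v = 0" "\<And>u. lev u \<le> r"
    "\<And>u w. (u, w) \<in> parcs G \<Longrightarrow> lev w \<le> lev u + 1"
    "\<And>u w. (u, w) \<in> parcs G \<Longrightarrow> lev u = lev w \<Longrightarrow> lev u = r"
proof -
  define P where "P u i \<longleftrightarrow> i = r \<or> (\<exists>p. awalk v p u \<and> length p = i)" for u i
  define lev where "lev u = (LEAST i. P u i)" for u
  have P: "P u (lev u)" for u
    unfolding lev_def by (rule LeastI[of _ r]) (simp add: P_def)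
  have le: "lev u \<le> i" if "P u i" for u i
    unfolding lev_def using that by (rule Least_le)
  have walk: "\<exists>p. awalk v p u \<and> length p = lev u" if "lev u < r" for u
    using P[of u] that by (auto simp: P_def)
  have le_r: "lev u \<le> r" for u by (rule le) (simp add: P_def)
  show ?thesis
  proof
    have "P v 0" using v by (auto simp: P_def awalk_Nil_iff)
    from le[OF this] show "lev v = 0" by simp
    show "lev u \<le> r" for u by (rule le_r)
  next
    fix u w assume uw: "(u, w) \<in> parcs G"
    show "lev w \<le> lev u + 1"
    proof (cases "lev u < r")
      case True
      then obtain p where "awalk v p u" "length p = lev u" using walk by blast
      moreover have "awalk u [(u, w)] w"
        using uw by (auto simp: awalk_simps dest: in_arcsD1 in_arcsD2)
      ultimately have "awalk v (p @ [(u, w)]) w" "length (p @ [(u, w)]) = lev u + 1"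
        by (auto intro: awalk_appendI)
      then show ?thesis by (intro le) (unfold P_def, blast)
    next
      case False
      then show ?thesis using le_r[of w] by simp
    qed
    assume same: "lev u = lev w"
    show "lev u = r"
    proof (rule ccontr)
      assume "lev u \<noteq> r"
      then have lt: "lev u < r" "lev w < r" using le_r[of u] same by auto
      obtain p q where p: "awalk v p u" "length p = lev u"
        and q: "awalk v q w" "length q = lev w"
        using walk lt by meson
      have "awalk u [(u, w)] w"
        using uw by (auto simp: awalk_simps dest: in_arcsD1 in_arcsD2)
      moreover have "awalk w (rev_path q) v" using q(1) by simp
      ultimately have "awalk v (p @ [(u, w)] @ rev_path q) v"
        using p(1) by (intro awalk_appendI)
      moreover have "length (rev_path q) = length q" by (induct q) auto
      then have len: "length (p @ [(u, w)] @ rev_path q) = 2 * lev u + 1"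
        using p q same by simp
      ultimately have "k \<le> 2 * lev u + 1"
        using no_short_odd_closed_walk[OF girth, of v "p @ [(u, w)] @ rev_path q"] by auto
      then show False using lt(1) r by linarith
    qed
  qed
qed

section \<open>Cutting off an eigenvector\<close>

text \<open>
  The test vector is \<open>y = s \<phi> x\<close>, where \<open>\<phi>\<close> cuts the eigenvector \<open>x\<close> off and the signs \<open>s\<close> are
  a proper 2-colouring of the support of \<open>\<phi>\<close>. The signs turn the form at \<open>y\<close> into minus the form at
  \<open>\<phi> x\<close>, and \<open>\<phi>(u) \<phi>(w) = (\<phi>(u)\<^sup>2 + \<phi>(w)\<^sup>2 - (\<phi>(u) - \<phi>(w))\<^sup>2) / 2\<close> together with the eigenvector
  equation shows that the latter is \<open>M\<close> times the squared norm of \<open>y\<close>, up to the energy of the cut-off.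
\<close>
lemma eigenvalue_sum_le_cutoff:
  fixes a :: "'a \<Rightarrow> 'a \<Rightarrow> real" and s \<phi> :: "'a \<Rightarrow> real"
  assumes sym: "\<And>u w. u \<in> V \<Longrightarrow> w \<in> V \<Longrightarrow> a u w = a w u"
    and a0: "\<And>u w. u \<in> V \<Longrightarrow> w \<in> V \<Longrightarrow> 0 \<le> a u w"
    and eigen: "\<And>u. u \<in> V \<Longrightarrow> (\<Sum>w\<in>V. a u w * x w) = M * x u"
    and low: "\<And>y. l * (\<Sum>u\<in>V. (y u)\<^sup>2) \<le> quad_form V a y"
    and s1: "\<And>u. (s u)\<^sup>2 = 1"
    and flip: "\<And>u w. u \<in> V \<Longrightarrow> w \<in> V \<Longrightarrow> a u w \<noteq> 0 \<Longrightarrow> \<phi> u \<noteq> 0 \<Longrightarrow> \<phi> w \<noteq> 0 \<Longrightarrow> s u * s w = - 1"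
  shows "(M + l) * (\<Sum>u\<in>V. (\<phi> u * x u)\<^sup>2)
    \<le> 1/2 * (\<Sum>u\<in>V. (x u)\<^sup>2 * (\<Sum>w\<in>V. a u w * (\<phi> u - \<phi> w)\<^sup>2))"
proof -
  define N where "N = (\<Sum>u\<in>V. (\<phi> u * x u)\<^sup>2)"
  define D where "D = (\<Sum>u\<in>V. \<Sum>w\<in>V. a u w * (\<phi> u - \<phi> w)\<^sup>2 * x u * x w)"
  define y where "y u = s u * \<phi> u * x u" for u
  have Ny: "(\<Sum>u\<in>V. (y u)\<^sup>2) = N"
    unfolding N_def y_def by (intro sum.cong refl) (simp add: power_mult_distrib s1)
  have diag: "(\<Sum>u\<in>V. \<Sum>w\<in>V. a u w * (\<phi> u)\<^sup>2 * x u * x w) = M * N"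
  proof -
    have "(\<Sum>u\<in>V. \<Sum>w\<in>V. a u w * (\<phi> u)\<^sup>2 * x u * x w) = (\<Sum>u\<in>V. (\<phi> u)\<^sup>2 * x u * (\<Sum>w\<in>V. a u w * x w))"
      by (simp add: sum_distrib_left mult_ac)
    also have "\<dots> = M * N"
      unfolding N_def sum_distrib_left[of M]
      by (intro sum.cong refl) (simp add: eigen power2_eq_square)
    finally show ?thesis .
  qed
  have diag': "(\<Sum>u\<in>V. \<Sum>w\<in>V. a u w * (\<phi> w)\<^sup>2 * x u * x w) = M * N"
    unfolding diag[symmetric] by (subst sum.swap) (auto intro!: sum.cong simp: sym)
  have "quad_form V a y = (\<Sum>u\<in>V. \<Sum>w\<in>V. 1/2 * (a u w * (\<phi> u - \<phi> w)\<^sup>2 * x u * x w)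
      - 1/2 * (a u w * (\<phi> u)\<^sup>2 * x u * x w) - 1/2 * (a u w * (\<phi> w)\<^sup>2 * x u * x w))"
    unfolding quad_form_def
  proof (intro sum.cong refl)
    fix u w assume uw: "u \<in> V" "w \<in> V"
    have "a u w * \<phi> u * \<phi> w * (s u * s w) = - (a u w * \<phi> u * \<phi> w)"
      using flip[OF uw] by (cases "a u w = 0 \<or> \<phi> u = 0 \<or> \<phi> w = 0") auto
    moreover have "a u w * y u * y w = a u w * \<phi> u * \<phi> w * (s u * s w) * x u * x w"
      by (simp add: y_def)
    ultimately have "a u w * y u * y w = - (a u w * \<phi> u * \<phi> w) * x u * x w"
      by simp
    then show "a u w * y u * y w = 1/2 * (a u w * (\<phi> u - \<phi> w)\<^sup>2 * x u * x w)
      - 1/2 * (a u w * (\<phi> u)\<^sup>2 * x u * x w) - 1/2 * (a u w * (\<phi> w)\<^sup>2 * x u * x w)"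
      by (simp add: power2_diff algebra_simps)
  qed
  also have "\<dots> = 1/2 * D - M * N"
    unfolding sum_subtractf sum_distrib_left[symmetric] diag diag' D_def by simp
  finally have "(M + l) * N \<le> 1/2 * D"
    using low[of y] unfolding Ny by (simp add: algebra_simps)
  also have "D \<le> (\<Sum>u\<in>V. \<Sum>w\<in>V. 1/2 * (a u w * (\<phi> u - \<phi> w)\<^sup>2 * (x u)\<^sup>2)
      + 1/2 * (a u w * (\<phi> u - \<phi> w)\<^sup>2 * (x w)\<^sup>2))"
    unfolding D_def
  proof (intro sum_mono)
    fix u w assume uw: "u \<in> V" "w \<in> V"
    have "x u * x w \<le> 1/2 * (x u)\<^sup>2 + 1/2 * (x w)\<^sup>2"
      using sum_squares_bound[of "x u" "x w"] by simp
    then have "a u w * (\<phi> u - \<phi> w)\<^sup>2 * (x u * x w) \<le> a u w * (\<phi> u - \<phi> w)\<^sup>2 * (1/2 * (x u)\<^sup>2 + 1/2 * (x w)\<^sup>2)"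
      using a0[OF uw] by (intro mult_left_mono) auto
    then show "a u w * (\<phi> u - \<phi> w)\<^sup>2 * x u * x w \<le> 1/2 * (a u w * (\<phi> u - \<phi> w)\<^sup>2 * (x u)\<^sup>2)
      + 1/2 * (a u w * (\<phi> u - \<phi> w)\<^sup>2 * (x w)\<^sup>2)"
      by (simp add: algebra_simps)
  qed
  also have "\<dots> = (\<Sum>u\<in>V. \<Sum>w\<in>V. a u w * (\<phi> u - \<phi> w)\<^sup>2 * (x u)\<^sup>2)"
  proof -
    have "(\<Sum>u\<in>V. \<Sum>w\<in>V. a u w * (\<phi> u - \<phi> w)\<^sup>2 * (x w)\<^sup>2) = (\<Sum>u\<in>V. \<Sum>w\<in>V. a u w * (\<phi> u - \<phi> w)\<^sup>2 * (x u)\<^sup>2)"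
      by (subst sum.swap) (auto intro!: sum.cong simp: sym power2_commute)
    then show ?thesis
      unfolding sum.distrib sum_distrib_left[symmetric] by simp
  qed
  also have "\<dots> = (\<Sum>u\<in>V. (x u)\<^sup>2 * (\<Sum>w\<in>V. a u w * (\<phi> u - \<phi> w)\<^sup>2))"
    by (simp add: sum_distrib_left mult_ac)
  finally show ?thesis by (simp add: N_def)
qed

text \<open>
  The cut-off is a function of the level that falls from 1 at level \<open>b\<close> to 0 at level \<open>b + L\<close>. Its
  energy at an edge is counted with the sizes of the two levels involved, so it should fall only
  between levels of moderate size. The average size of the \<open>L\<close> levels is at most \<open>n / L\<close>, hence at
  least half of the steps lie between two levels of size at most \<open>4 n / L\<close>. If \<open>\<phi>\<close> falls equally at
  these good steps, each drop is at most \<open>2 / L\<close>, and the energy is at most of order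
  \<open>(n / L) (1 / L)\<^sup>2\<close> times the weight of \<open>x\<close> in the levels up to \<open>b + L\<close>. Slow growth lets this weight
  be absorbed by the part up to \<open>b\<close>, where \<open>\<phi> = 1\<close>. The bound depends on level sizes but not on
  \<open>M\<close>, which is what gives the third power of \<open>L\<close>.
\<close>
lemma eigenvalue_sum_le_of_slow_growth:
  fixes a :: "'a \<Rightarrow> 'a \<Rightarrow> real" and lev :: "'a \<Rightarrow> nat"
  assumes fin: "finite V"
    and sym: "\<And>u w. u \<in> V \<Longrightarrow> w \<in> V \<Longrightarrow> a u w = a w u"
    and a0: "\<And>u w. u \<in> V \<Longrightarrow> w \<in> V \<Longrightarrow> 0 \<le> a u w"
    and a1: "\<And>u w. u \<in> V \<Longrightarrow> w \<in> V \<Longrightarrow> a u w \<le> 1"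
    and eigen: "\<And>u. u \<in> V \<Longrightarrow> (\<Sum>w\<in>V. a u w * x w) = M * x u"
    and low: "\<And>y. l * (\<Sum>u\<in>V. (y u)\<^sup>2) \<le> quad_form V a y"
    and step: "\<And>u w. u \<in> V \<Longrightarrow> w \<in> V \<Longrightarrow> a u w \<noteq> 0 \<Longrightarrow> lev w \<le> lev u + 1"
    and same: "\<And>u w. u \<in> V \<Longrightarrow> w \<in> V \<Longrightarrow> a u w \<noteq> 0 \<Longrightarrow> lev u = lev w \<Longrightarrow> b + L \<le> lev u"
    and L: "0 < L"
    and slow: "(\<Sum>u\<in>{u\<in>V. lev u \<le> b + L}. (x u)\<^sup>2) \<le> 2 * (\<Sum>u\<in>{u\<in>V. lev u \<le> b}. (x u)\<^sup>2)"
    and pos: "(\<Sum>u\<in>{u\<in>V. lev u \<le> b}. (x u)\<^sup>2) > 0"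
  shows "M + l \<le> 32 * real (card V) / real L ^ 3"
proof -
  define n where "n = card V"
  have n: "n > 0"
  proof -
    have "V \<noteq> {}" using pos by auto
    then show ?thesis using fin by (simp add: n_def card_gt_0_iff)
  qed
  define N where "N j = card {u\<in>V. lev u = j}" for j
  (* At most n/T = L/4 levels are larger than T, and each of them spoils at most two steps. *)
  define T where "T = 4 * real n / real L"
  have T: "T > 0" using n L by (simp add: T_def)
  define good where "good j \<longleftrightarrow> real (N j) \<le> T \<and> real (N (Suc j)) \<le> T" for j
  define I where "I = {b..<b+L}"
  define g where "g = card {i\<in>I. good i}"
  have total: "(\<Sum>j\<in>J. real (N j)) \<le> real n" if "finite J" for J
  proof -
    have "(\<Sum>j\<in>J. N j) = card (\<Union>j\<in>J. {u\<in>V. lev u = j})"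
      unfolding N_def using fin that by (intro card_UN_disjoint[symmetric]) auto
    also have "\<dots> \<le> n"
      unfolding n_def using fin by (intro card_mono) auto
    finally show ?thesis by (metis of_nat_le_iff of_nat_sum)
  qed
  have g: "real L / 2 \<le> real g"
  proof -
    have "real (card {i\<in>I. \<not> good i}) = (\<Sum>i\<in>{i\<in>I. \<not> good i}. 1)" by simp
    also have "\<dots> \<le> (\<Sum>i\<in>{i\<in>I. \<not> good i}. (real (N i) + real (N (Suc i))) / T)"
    proof (intro sum_mono)
      fix i assume "i \<in> {i\<in>I. \<not> good i}"
      then have "T \<le> real (N i) + real (N (Suc i))" by (auto simp: good_def)
      then show "1 \<le> (real (N i) + real (N (Suc i))) / T" using T by simp
    qed
    also have "\<dots> \<le> (\<Sum>i\<in>I. (real (N i) + real (N (Suc i))) / T)"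
      using T by (intro sum_mono2) (auto simp: I_def)
    also have "\<dots> = ((\<Sum>i\<in>I. real (N i)) + (\<Sum>i\<in>Suc ` I. real (N i))) / T"
      by (simp add: sum_divide_distrib sum.distrib sum.reindex add_divide_distrib)
    also have "\<dots> \<le> (real n + real n) / T"
      using T by (intro divide_right_mono add_mono total) (auto simp: I_def)
    also have "\<dots> = real L / 2" using n L by (simp add: T_def field_simps)
    finally have "real (card {i\<in>I. \<not> good i}) \<le> real L / 2" .
    moreover have "card {i\<in>I. good i} + card {i\<in>I. \<not> good i} = card I"
    proof -
      have "I = {i\<in>I. good i} \<union> {i\<in>I. \<not> good i}" by auto
      then show ?thesis
        by (metis (no_types, lifting) I_def card_Un_disjoint disjoint_iff finite_Un
            finite_atLeastLessThan mem_Collect_eq)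
    qed
    then have "real g + real (card {i\<in>I. \<not> good i}) = real L"
      unfolding g_def by (simp add: I_def flip: of_nat_add)
    ultimately show ?thesis by linarith
  qed
  then have g0: "g > 0" using L by (auto intro: Nat.gr0I)
  define c where "c j = card {i\<in>I. j \<le> i \<and> good i}" for j
  define h where "h j = (if j \<in> I \<and> good j then 1 else 0 :: nat)" for j
  define \<phi> where "\<phi> u = real (c (lev u)) / real g" for u
  (* The total drop of c is g, so phi falls by 1/g at every good step of the block. *)
  have c_b: "c j = g" if "j \<le> b" for j
    unfolding c_def g_def using that by (intro arg_cong[of _ _ card]) (auto simp: I_def)
  have c_end: "c j = 0" if "b + L \<le> j" for j
    unfolding c_def using that by (auto simp: I_def)
  have c_step: "c j = c (Suc j) + h j" for j
  proof -
    have "{i\<in>I. j \<le> i \<and> good i} =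
        (if j \<in> I \<and> good j then insert j else id) {i\<in>I. Suc j \<le> i \<and> good i}"
      by (auto simp: Suc_le_eq le_less)
    then show ?thesis by (simp add: c_def h_def I_def)
  qed
  have hN: "real (h j) * real (N j) \<le> T" "real (h j) * real (N (Suc j)) \<le> T" for j
    using T by (auto simp: h_def good_def)
  have h_end: "h j = 0" if "b + L \<le> j" for j
    using that by (auto simp: h_def I_def)
  have local: "(\<Sum>w\<in>V. a u w * (\<phi> u - \<phi> w)\<^sup>2) \<le> (if lev u \<le> b + L then 2 * T / (real g)\<^sup>2 else 0)"
    if u: "u \<in> V" for u
  proof -
    define p where "p = real (h (lev u))"
    define q where "q = (if lev u = 0 then 0 else real (h (lev u - 1)))"
    have "(\<Sum>w\<in>V. a u w * (\<phi> u - \<phi> w)\<^sup>2)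
      \<le> (\<Sum>w\<in>V. (if lev w = Suc (lev u) then p else 0) / (real g)\<^sup>2
          + (if lev u = Suc (lev w) then q else 0) / (real g)\<^sup>2)"
    proof (intro sum_mono)
      fix w assume w: "w \<in> V"
      show "a u w * (\<phi> u - \<phi> w)\<^sup>2 \<le> (if lev w = Suc (lev u) then p else 0) / (real g)\<^sup>2
          + (if lev u = Suc (lev w) then q else 0) / (real g)\<^sup>2"
      proof (cases "a u w = 0")
        case True then show ?thesis by (auto simp: p_def q_def)
      next
        case False
        have le: "a u w * (\<phi> u - \<phi> w)\<^sup>2 \<le> (\<phi> u - \<phi> w)\<^sup>2"
          using a1[OF u w] by (intro mult_left_le_one_le) (auto simp: a0 u w)
        have "lev w \<le> Suc (lev u)" "lev u \<le> Suc (lev w)"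
          using step[OF u w False] step[OF w u] False sym[OF u w] by auto
        then consider "lev u = lev w" | "lev w = Suc (lev u)" | "lev u = Suc (lev w)"
          by linarith
        then show ?thesis
        proof cases
          case 1 then show ?thesis by (simp add: \<phi>_def)
        next
          case 2
          have "\<phi> u - \<phi> w = p / real g"
            using c_step[of "lev u"] 2 by (simp add: \<phi>_def p_def add_divide_distrib)
          then have "(\<phi> u - \<phi> w)\<^sup>2 = p / (real g)\<^sup>2"
            by (auto simp: power_divide p_def h_def)
          then show ?thesis using le 2 by simp
        next
          case 3
          have "\<phi> u - \<phi> w = - q / real g"
            using c_step[of "lev w"] 3 by (simp add: \<phi>_def q_def add_divide_distrib)
          then have "(\<phi> u - \<phi> w)\<^sup>2 = q / (real g)\<^sup>2"
            by (auto simp: power_divide q_def h_def)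
          then show ?thesis using le 3 by simp
        qed
      qed
    qed
    also have "\<dots> = (p * real (N (Suc (lev u))) + q * real (card {w\<in>V. lev u = Suc (lev w)})) / (real g)\<^sup>2"
    proof -
      have "(\<Sum>w\<in>V. if P w then r else 0) = r * real (card {w\<in>V. P w})" for P and r :: real
        using fin by (simp add: sum.If_cases Int_def mult.commute)
      then show ?thesis
        unfolding sum.distrib sum_divide_distrib[symmetric] add_divide_distrib by (simp add: N_def)
    qed
    also have "\<dots> \<le> (if lev u \<le> b + L then 2 * T / (real g)\<^sup>2 else 0)"
    proof (cases "lev u \<le> b + L")
      case True
      have "q * real (card {w\<in>V. lev u = Suc (lev w)}) \<le> T"
      proof (cases "lev u")
        case 0 then show ?thesis using T by (simp add: q_def)
      next
        case (Suc j)
        then have "{w\<in>V. lev u = Suc (lev w)} = {w\<in>V. lev w = j}" by auto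
        then show ?thesis using hN(1)[of j] Suc by (simp add: q_def N_def)
      qed
      moreover have "p * real (N (Suc (lev u))) \<le> T"
        unfolding p_def by (rule hN)
      ultimately show ?thesis using True by (simp add: divide_right_mono)
    next
      case False
      then have "p = 0" "q = 0" by (auto simp: p_def q_def h_end)
      then show ?thesis using False by simp
    qed
    finally show ?thesis .
  qed
  define W where "W j = (\<Sum>u\<in>{u\<in>V. lev u \<le> j}. (x u)\<^sup>2)" for j
  have "(M + l) * (\<Sum>u\<in>V. (\<phi> u * x u)\<^sup>2)
      \<le> 1/2 * (\<Sum>u\<in>V. (x u)\<^sup>2 * (\<Sum>w\<in>V. a u w * (\<phi> u - \<phi> w)\<^sup>2))"
  proof (rule eigenvalue_sum_le_cutoff[where s = "\<lambda>u. (- 1) ^ lev u", OF sym a0 eigen low])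
    show "((- 1) ^ lev u)\<^sup>2 = (1::real)" for u by (simp add: power_mult[symmetric] mult.commute)
    fix u w assume uw: "u \<in> V" "w \<in> V" "a u w \<noteq> 0" "\<phi> u \<noteq> 0" "\<phi> w \<noteq> 0"
    have "lev u < b + L" using uw(4) c_end[of "lev u"] by (force simp: \<phi>_def)
    then have "lev u \<noteq> lev w" using same uw by fastforce
    moreover have "lev w \<le> Suc (lev u)" "lev u \<le> Suc (lev w)"
      using step[OF uw(1-3)] step[OF uw(2,1)] uw sym by auto
    ultimately have "lev w = Suc (lev u) \<or> lev u = Suc (lev w)" by linarith
    then show "(- 1) ^ lev u * (- 1) ^ lev w = (- 1 :: real)" by (auto simp flip: power_add)
  qed auto
  also have "(\<Sum>u\<in>V. (x u)\<^sup>2 * (\<Sum>w\<in>V. a u w * (\<phi> u - \<phi> w)\<^sup>2))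
      \<le> (\<Sum>u\<in>V. (x u)\<^sup>2 * (if lev u \<le> b + L then 2 * T / (real g)\<^sup>2 else 0))"
    by (intro sum_mono mult_left_mono local) auto
  also have "\<dots> = 2 * T / (real g)\<^sup>2 * W (b + L)"
    using fin by (simp add: if_distrib W_def sum.If_cases Int_def sum_distrib_left mult_ac cong: if_cong)
  also have "\<dots> \<le> 2 * T / (real g)\<^sup>2 * (2 * W b)"
    using slow T by (intro mult_left_mono) (auto simp: W_def)
  finally have main: "(M + l) * (\<Sum>u\<in>V. (\<phi> u * x u)\<^sup>2) \<le> 2 * T / (real g)\<^sup>2 * W b" by simp
  have inner: "W b \<le> (\<Sum>u\<in>V. (\<phi> u * x u)\<^sup>2)"
  proof -
    have "W b = (\<Sum>u\<in>{u\<in>V. lev u \<le> b}. (\<phi> u * x u)\<^sup>2)"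
      unfolding W_def using g0 by (intro sum.cong) (auto simp: \<phi>_def c_b)
    also have "\<dots> \<le> (\<Sum>u\<in>V. (\<phi> u * x u)\<^sup>2)"
      using fin by (intro sum_mono2) auto
    finally show ?thesis .
  qed
  show ?thesis
  proof (cases "M + l \<le> 0")
    case True
    also have "0 \<le> 32 * real (card V) / real L ^ 3" by simp
    finally show ?thesis .
  next
    case False
    then have "(M + l) * W b \<le> (M + l) * (\<Sum>u\<in>V. (\<phi> u * x u)\<^sup>2)"
      using inner by (intro mult_left_mono) auto
    with main have "(M + l) * W b \<le> 2 * T / (real g)\<^sup>2 * W b" by linarith
    then have "M + l \<le> 2 * T / (real g)\<^sup>2" using pos unfolding W_def by (rule mult_right_le_imp_le)
    also have "\<dots> \<le> 2 * T / (real L / 2)\<^sup>2"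
      using g T L by (intro divide_left_mono power_mono) auto
    also have "\<dots> = 32 * real (card V) / real L ^ 3"
      using L by (simp add: T_def n_def power2_eq_square power3_eq_cube field_simps)
    finally show ?thesis .
  qed
qed

text \<open>
  If the function more than doubled over each of the \<open>m\<close> consecutive blocks of length \<open>L\<close>, it would
  grow by a factor of \<open>2 ^ m\<close>.
\<close>
lemma slow_growth_block:
  fixes W :: "nat \<Rightarrow> real"
  assumes "W (b + m * L) < 2 ^ m * W b"
  shows "\<exists>j<m. W (b + j * L + L) \<le> 2 * W (b + j * L)"
proof (rule ccontr)
  assume "\<not> ?thesis"
  then have fast: "2 * W (b + j * L) < W (b + j * L + L)" if "j < m" for j
    using that by fastforce
  have "2 ^ j * W b \<le> W (b + j * L)" if "j \<le> m" for j
    using that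
  proof (induction j)
    case (Suc j)
    then show ?case using fast[of j] by (simp add: algebra_simps)
  qed simp
  then show False using assms by force
qed

text \<open>
  A vertex \<open>v\<close> that carries at least the average weight works: the eigenvector equation expresses
  \<open>M x(v)\<close> through the neighbours, and the Cauchy-Schwarz inequality bounds it by their weight. This
  is the starting weight for the growth argument; unlike the weight of \<open>v\<close> alone, it has a lower
  bound in terms of \<open>M / n\<close>, so that no dependence on \<open>n\<close> enters.
\<close>
lemma eigenvector_neighbourhood_weight:
  fixes a :: "'a \<Rightarrow> 'a \<Rightarrow> real"
  assumes fin: "finite V" and "V \<noteq> {}"
    and a: "\<And>u w. u \<in> V \<Longrightarrow> w \<in> V \<Longrightarrow> \<bar>a u w\<bar> \<le> 1"
    and norm: "(\<Sum>u\<in>V. (x u)\<^sup>2) = 1"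
    and eigen: "\<And>u. u \<in> V \<Longrightarrow> (\<Sum>w\<in>V. a u w * x w) = M * x u"
  obtains v where "v \<in> V"
    "M\<^sup>2 / (real (card V))\<^sup>2 \<le> (\<Sum>w\<in>{w\<in>V. a v w \<noteq> 0}. (x w)\<^sup>2)"
proof -
  have n: "real (card V) > 0" using fin \<open>V \<noteq> {}\<close> by (simp add: card_gt_0_iff)
  obtain v where v: "v \<in> V" "1 / real (card V) \<le> (x v)\<^sup>2"
  proof (rule ccontr)
    assume "\<not> thesis"
    then have "(\<Sum>u\<in>V. (x u)\<^sup>2) < (\<Sum>u\<in>V. 1 / real (card V))"
      using that fin \<open>V \<noteq> {}\<close> by (intro sum_strict_mono) (auto simp: not_le[symmetric])
    then show False using norm n by simp
  qed
  define S where "S = {w\<in>V. a v w \<noteq> 0}"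
  have S: "finite S" "S \<subseteq> V" using fin by (auto simp: S_def)
  have "M\<^sup>2 * (1 / real (card V)) \<le> M\<^sup>2 * (x v)\<^sup>2"
    using v(2) by (intro mult_left_mono) auto
  also have "\<dots> = (\<Sum>w\<in>V. a v w * x w)\<^sup>2"
    using eigen[OF v(1)] by (simp add: power_mult_distrib)
  also have "(\<Sum>w\<in>V. a v w * x w) = (\<Sum>w\<in>S. a v w * x w)"
    using fin by (intro sum.mono_neutral_right) (auto simp: S_def)
  also have "\<dots>\<^sup>2 \<le> (\<Sum>w\<in>S. (a v w)\<^sup>2) * (\<Sum>w\<in>S. (x w)\<^sup>2)"
    by (rule Cauchy_Schwarz_ineq_sum)
  also have "\<dots> \<le> real (card V) * (\<Sum>w\<in>S. (x w)\<^sup>2)"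
  proof (intro mult_right_mono sum_nonneg)
    have "(\<Sum>w\<in>S. (a v w)\<^sup>2) \<le> (\<Sum>w\<in>S. 1)"
      using a[OF v(1)] S(2) by (intro sum_mono) (auto simp: abs_square_le_1)
    also have "\<dots> \<le> real (card V)" using S fin by (simp add: card_mono)
    finally show "(\<Sum>w\<in>S. (a v w)\<^sup>2) \<le> real (card V)" .
  qed auto
  finally have "M\<^sup>2 / (real (card V))\<^sup>2 \<le> (\<Sum>w\<in>S. (x w)\<^sup>2)"
    using n by (simp add: field_simps power2_eq_square)
  then show ?thesis using that v(1) by (simp add: S_def)
qed

section \<open>Graphs of high odd girth\<close>

text \<open>
  If \<open>\<lambda>\<^sub>1 \<le> n / 2 ^ B\<close>, it suffices that the least eigenvalue is not positive. Otherwise the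
  neighbourhood of a suitable vertex has weight more than \<open>1 / 2 ^ (2 * B)\<close>, while the whole graph
  has weight 1, so one of \<open>2 * B\<close> blocks of \<open>L\<close> levels starting at level 1 grows slowly. All these
  blocks end at level \<open>k div 2\<close> at the latest, and every level below that one is an independent set.
\<close>
lemma extreme_eigenvalue_sum_le:
  assumes "pair_graph G" and verts: "pverts G = {0..<n}" and n: "n \<ge> 1" and girth: "enat k \<le> odd_girth G"
    and L: "L > 0" and BL: "2 * B * L + 1 \<le> k div 2"
  shows "(graph_eigenvalue G 1 + graph_eigenvalue G n) / real n \<le> 32 / real L ^ 3 + 1 / 2 ^ B"
proof -
  interpret pair_graph G by fact
  define a where "a u w = (if (u, w) \<in> parcs G then 1 else 0 :: real)" for u w
  have sym: "a u w = a w u" for u w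
    unfolding a_def using arcs_symmetric by metis
  have A: "adjacency_matrix G = mat n n (\<lambda>(i, j). a i j)"
    by (simp add: adjacency_matrix_def verts a_def)
  define M where "M = graph_eigenvalue G 1"
  define l where "l = graph_eigenvalue G n"
  have low: "l * (\<Sum>u<n. (y u)\<^sup>2) \<le> quad_form {..<n} a y" for y
    unfolding l_def graph_eigenvalue_def A
    by (rule least_eigenvalue_le_quad_form[OF n sym])
  have V: "finite {..<n}" "{..<n} \<noteq> {}" using n by (auto simp: lessThan_empty_iff)
  obtain x where x: "(\<Sum>u<n. (x u)\<^sup>2) = 1"
    "\<And>u. u \<in> {..<n} \<Longrightarrow> (\<Sum>w<n. a u w * x w) = M * x u"
    using largest_eigenvalue_unit_eigenvector[OF n sym]
    unfolding M_def graph_eigenvalue_def A by fastforce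
  have "M + l \<le> 32 * real n / real L ^ 3 + real n / 2 ^ B"
  proof (cases "M \<le> real n / 2 ^ B")
    case True
    (* A graph has no loops, so the form vanishes at every coordinate vector. *)
    have "l \<le> 0"
    proof -
      have "quad_form {..<n} a (\<lambda>u. if u = 0 then 1 else 0) = a 0 0"
      proof -
        have "quad_form {..<n} a (\<lambda>u. if u = 0 then 1 else 0)
            = (\<Sum>u<n. \<Sum>w<n. if w = 0 then if u = 0 then a 0 0 else 0 else 0)"
          unfolding quad_form_def by (intro sum.cong) auto
        also have "\<dots> = a 0 0" using n by simp
        finally show ?thesis .
      qed
      also have "\<dots> = 0" using no_loops' by (auto simp: a_def)
      finally show ?thesis
        using low[of "\<lambda>u. if u = 0 then 1 else 0"] n
        by (simp add: if_distrib[of "\<lambda>t. t\<^sup>2"] cong: if_cong)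
    qed
    moreover have "0 \<le> 32 * real n / real L ^ 3" by simp
    ultimately show ?thesis using True by linarith
  next
    case False
    obtain v where v: "v < n" and nbrs: "M\<^sup>2 / (real n)\<^sup>2 \<le> (\<Sum>w\<in>{w\<in>{..<n}. a v w \<noteq> 0}. (x w)\<^sup>2)"
    proof (rule eigenvector_neighbourhood_weight[OF V _ x])
      show "\<bar>a u w\<bar> \<le> 1" for u w by (simp add: a_def)
    qed (use that in auto)
    have "2 * (k div 2) \<le> k" "v \<in> pverts G" using v verts by auto
    then obtain lev where lev: "lev v = 0" "\<And>u. lev u \<le> k div 2"
      "\<And>u w. (u, w) \<in> parcs G \<Longrightarrow> lev w \<le> lev u + 1"
      "\<And>u w. (u, w) \<in> parcs G \<Longrightarrow> lev u = lev w \<Longrightarrow> lev u = k div 2"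
      using truncated_distance[OF girth, of "k div 2" v] by blast
    define W where "W j = (\<Sum>u\<in>{u\<in>{..<n}. lev u \<le> j}. (x u)\<^sup>2)" for j
    have mono: "W i \<le> W j" if "i \<le> j" for i j
      unfolding W_def using that by (intro sum_mono2) auto
    have "1 < 2 ^ (2 * B) * (M\<^sup>2 / (real n)\<^sup>2)"
    proof -
      have "1 < 2 ^ B * M / real n" using False n by (simp add: field_simps)
      then have "1 < (2 ^ B * M / real n)\<^sup>2" by (simp add: one_less_power)
      then show ?thesis by (simp add: power_mult_distrib power_divide power_even_eq)
    qed
    also have "M\<^sup>2 / (real n)\<^sup>2 \<le> W 1"
    proof (rule order_trans[OF nbrs])
      show "(\<Sum>w\<in>{w\<in>{..<n}. a v w \<noteq> 0}. (x w)\<^sup>2) \<le> W 1"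
        unfolding W_def using lev(3)[of v] lev(1)
        by (intro sum_mono2) (auto simp: a_def split: if_splits)
    qed
    (* Over 2 * B doublings the weight would exceed the total weight 1. *)
    finally have big: "1 < 2 ^ (2 * B) * W 1" by simp
    have "W (1 + 2 * B * L) \<le> (\<Sum>u<n. (x u)\<^sup>2)"
      unfolding W_def by (intro sum_mono2) auto
    then obtain j where j: "j < 2 * B" "W (1 + j * L + L) \<le> 2 * W (1 + j * L)"
      using slow_growth_block[of W 1 "2 * B" L] big x(1) by auto
    have "(j + 1) * L \<le> 2 * B * L" using j(1) by (intro mult_le_mono1) simp
    then have end_le: "1 + j * L + L \<le> k div 2" using BL by (simp add: algebra_simps)
    have "0 < 2 ^ (2 * B) * W 1" using big by linarith
    then have "0 < W 1" by (simp add: zero_less_mult_iff)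
    then have pos: "0 < W (1 + j * L)" using mono[of 1 "1 + j * L"] by simp
    have "M + l \<le> 32 * real (card {..<n}) / real L ^ 3"
    proof (rule eigenvalue_sum_le_of_slow_growth[where lev = lev and b = "1 + j * L" and a = a and x = x])
      fix u w assume "a u w \<noteq> 0"
      then have uw: "(u, w) \<in> parcs G" by (auto simp: a_def split: if_splits)
      show "lev w \<le> lev u + 1" by (rule lev(3)[OF uw])
      assume "lev u = lev w"
      then show "1 + j * L + L \<le> lev u" using lev(4)[OF uw] end_le by simp
    qed (use sym low L x j(2) pos in \<open>auto simp: a_def W_def\<close>)
    then show ?thesis by (simp add: add_increasing2)
  qed
  then have "M + l \<le> real n * (32 / real L ^ 3 + 1 / 2 ^ B)"
    by (simp add: algebra_simps)
  then show ?thesis using n by (simp add: M_def l_def divide_le_eq mult.commute)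
qed

text \<open>
  A bound on all members bounds the supremum because the defining set is nonempty: it contains the
  value of the graph with a single vertex, whose odd girth is infinite.
\<close>
lemma odd_girth_gamma_le:
  assumes "\<And>n G. n \<ge> 1 \<Longrightarrow> pair_graph G \<Longrightarrow> pverts G = {0..<n} \<Longrightarrow> enat k \<le> odd_girth G \<Longrightarrow>
    (graph_eigenvalue G 1 + graph_eigenvalue G n) / real n \<le> c"
  shows "odd_girth_gamma k \<le> c"
  unfolding odd_girth_gamma_def
proof (rule cSup_least)
  define H :: "nat pair_pre_digraph" where "H = \<lparr>pverts = {0..<1}, parcs = {}\<rparr>"
  interpret pair_graph H
    by unfold_locales (auto simp: H_def symmetric_def sym_def)
  have arcs: "parcs H = {}" by (simp add: H_def)
  have "\<not> cycle p" for p
    by (cases p) (auto simp: cycle_def awalk_Cons_iff arcs)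
  then have "odd_girth H = \<infinity>" by (simp add: odd_girth_def top_enat_def)
  moreover have "H \<in> simple_graphs_on 1"
    using pair_graph by (simp add: simple_graphs_on_def H_def)
  ultimately show "{(graph_eigenvalue G 1 + graph_eigenvalue G n) / real n |n G.
      n \<ge> 1 \<and> G \<in> simple_graphs_on n \<and> odd_girth G \<ge> enat k} \<noteq> {}"
    by force
qed (use assms in \<open>auto simp: simple_graphs_on_def\<close>)

theorem theorem1p4:
  shows "\<exists>C>0. \<exists>k0\<ge>3::nat. \<forall>k\<ge>k0. odd k \<longrightarrow>
           odd_girth_gamma k \<le> C * real k powi (-3) * ln (real k) ^ 3"
proof -
  (* 2 ^ B must reach k ^ 3, for which B >= 6 ln k suffices because 2 >= exp (1/2). The 2 * B blocks
     of length L must fit into about k/2 levels, which leaves L of order k / ln k; the constant 32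
     only has to exceed 24. *)
  define B where "B k = nat \<lceil>6 * ln (real k)\<rceil>" for k
  define L where "L k = nat \<lfloor>real k / (32 * ln (real k))\<rfloor>" for k
  have "\<forall>\<^sub>F k in sequentially. 2 * (6 * ln (real k) + 1) * (real k / (32 * ln (real k))) + 1 \<le> (real k - 1) / 2"
    by real_asymp
  moreover have "\<forall>\<^sub>F k in sequentially. real k / (64 * ln (real k)) \<le> real k / (32 * ln (real k)) - 1"
    by real_asymp
  moreover have "\<forall>\<^sub>F k in sequentially. 1 \<le> ln (real k)" by real_asymp
  ultimately have "\<forall>\<^sub>F k in sequentially. odd_girth_gamma k \<le> 10000000 * real k powi (-3) * ln (real k) ^ 3"
  proof eventually_elim
    case (elim k)
    have k: "real k > 0" using elim(3) by (cases "k = 0") auto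
    have B: "6 * ln (real k) \<le> real (B k)" "real (B k) \<le> 6 * ln (real k) + 1"
      unfolding B_def using elim(3) by linarith+
    have L: "real (L k) \<le> real k / (32 * ln (real k))" "real k / (32 * ln (real k)) - 1 \<le> real (L k)"
      unfolding L_def using elim(3) k by (simp_all add: of_nat_floor)
    have ln_pos: "ln (real k) > 0" using elim(3) by linarith
    have "0 < real k / (64 * ln (real k))"
      using k ln_pos by (intro divide_pos_pos mult_pos_pos) auto
    then have L': "real k / (64 * ln (real k)) \<le> real (L k)" "L k > 0"
      using L(2) elim(2) by linarith+
    have "real (2 * B k * L k + 1) \<le> 2 * (6 * ln (real k) + 1) * (real k / (32 * ln (real k))) + 1"
    proof -
      have "real (B k) * real (L k) \<le> (6 * ln (real k) + 1) * (real k / (32 * ln (real k)))"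
        using B L ln_pos by (intro mult_mono) auto
      then show ?thesis
        by (simp only: of_nat_add of_nat_mult of_nat_numeral of_nat_1 mult.assoc
            add_le_cancel_right mult_le_cancel_left_pos zero_less_numeral)
    qed
    also have "\<dots> \<le> (real k - 1) / 2" by (rule elim(1))
    also have "\<dots> \<le> real (k div 2)"
    proof -
      have "k \<le> 2 * (k div 2) + 1" by simp
      then have "real k \<le> real (2 * (k div 2) + 1)" by (simp only: of_nat_le_iff)
      then show ?thesis by simp
    qed
    finally have "2 * B k * L k + 1 \<le> k div 2" by (simp only: of_nat_le_iff)
    then have bound: "odd_girth_gamma k \<le> 32 / real (L k) ^ 3 + 1 / 2 ^ B k"
      using L'(2) by (intro odd_girth_gamma_le extreme_eigenvalue_sum_le)
    have "32 / real (L k) ^ 3 \<le> 32 / (real k / (64 * ln (real k))) ^ 3"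
      using L' k ln_pos by (intro divide_left_mono power_mono mult_pos_pos divide_pos_pos zero_less_power) auto
    also have "\<dots> = 8388608 * (ln (real k) ^ 3 / real k ^ 3)"
      by (simp add: power_divide power_mult_distrib)
    finally have "32 / real (L k) ^ 3 \<le> 8388608 * (ln (real k) ^ 3 / real k ^ 3)" .
    moreover have "1 / 2 ^ B k \<le> ln (real k) ^ 3 / real k ^ 3"
    proof -
      have "(exp (1/2 :: real))\<^sup>2 = exp 1" by (simp flip: exp_of_nat_mult)
      also have "\<dots> \<le> 2\<^sup>2" using exp_le by simp
      finally have half: "exp (1/2 :: real) \<le> 2" by (rule power2_le_imp_le) simp
      have "real k ^ 3 = exp (3 * ln (real k))"
        using k exp_of_nat_mult[of 3 "ln (real k)"] by simp
      also have "\<dots> \<le> exp (real (B k) * (1/2))" using B(1) by simp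
      also have "\<dots> = exp (1/2) ^ B k" by (rule exp_of_nat_mult)
      also have "\<dots> \<le> 2 ^ B k" using half by (intro power_mono) auto
      finally have "real k ^ 3 \<le> 2 ^ B k" .
      then have "1 / 2 ^ B k \<le> 1 / real k ^ 3" using k by (intro divide_left_mono) auto
      also have "\<dots> \<le> ln (real k) ^ 3 / real k ^ 3"
        using elim(3) k by (intro divide_right_mono one_le_power) auto
      finally show ?thesis .
    qed
    moreover have "0 \<le> ln (real k) ^ 3 / real k ^ 3" using elim(3) k by simp
    ultimately have "odd_girth_gamma k \<le> 10000000 * (ln (real k) ^ 3 / real k ^ 3)"
      using bound by linarith
    then show ?case by (simp add: power_int_minus field_simps)
  qed
  then obtain k1 where "\<forall>k\<ge>k1. odd_girth_gamma k \<le> 10000000 * real k powi (-3) * ln (real k) ^ 3"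
    unfolding eventually_sequentially by blast
  then show ?thesis
    by (intro exI[of _ "10000000 :: real"] conjI exI[of _ "max 3 k1"]) auto
qed

end
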